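(* Let $\mathcal{T}$ be a finite set, $\sigma:\mathcal{T}\to\mathcal{T}$ an involution, and $\kappa:\mathcal{T}\to(0,\infty)$ a weight with $\kappa(z)\kappa(\sigma(z))=K$ for all $z$. Let $\mathsf{T}=\Delta^2\mathcal{R}$, i.e. $(\mathsf{T}f)(z)=\kappa(z)f(\sigma(z))$. Then $\mathsf{T}^2=KI$ and $\operatorname{spec}(\mathsf{T})\subseteq\{\pm\sqrt K\}$, and the normalized operator $\widetilde{\mathcal{T}}=K^{-1/2}\mathsf{T}$ is an involution. For the biased random walk ($\mathcal{T}=\{1,\dots,a-1\}$, $\sigma(z)=a-z$, $\kappa(z)=(p/q)^{a-z}$) with $a\ge 3$ both signs occur: the eigenvectors $\varphi_\nu$ of the walk satisfy $\mathsf{T}\varphi_\nu=\epsilon_\nu\sqrt K\,\varphi_\nu$ with $\epsilon_\nu=(-1)^{\nu+1}$, $\nu=1,\dots,a-1$, and the multiplicities of $+\sqrt K$ and $-\sqrt K$ are $\lceil (a-1)/2\rceil$ and $\lfloor (a-1)/2\rfloor$ respectively; they are equal when $a$ is odd and differ by one when $a$ is even. For $a=2$ there is a single mode and only $\epsilon_1=+1$ occurs. In general the parity decomposition may be trivial, with all $\epsilon_\nu=+1$, in which case $\operatorname{spec}(\mathsf{T})=\{+\sqrt K\}$.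
   Context: $(\mathcal{R}f)(z)=f(\sigma(z))$ and $\Delta=\operatorname{diag}(\sqrt{\kappa(z)})$ act on functions on $\mathcal{T}$. The biased random walk on $\{0,\dots,a\}$ has $p,q>0$, $p+q=1$, steps $z\to z+1$ with probability $p$ and $z\to z-1$ with probability $q$, and is absorbed at $0$ and $a$; its transition matrix restricted to $\{1,\dots,a-1\}$ has eigenvalues $\lambda_\nu=2\sqrt{pq}\cos(\pi\nu/a)$ with right eigenvectors $\varphi_\nu(z)\propto(q/p)^{z/2}\sin(\pi\nu z/a)$, $\nu=1,\dots,a-1$, and $K=(p/q)^a$. In general, $\epsilon_\nu\in\{+1,-1\}$ denotes the sign in $\mathsf{T}\varphi_\nu=\epsilon_\nu\sqrt K\varphi_\nu$, where $(\varphi_\nu)$ is a basis of eigenvectors of the transition matrix that are also eigenvectors of $\mathsf{T}$. *)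

theory Defs
  imports Complex_Main "HOL-Library.Function_Algebras"
begin

text \<open>
  Functions on a set \<open>S\<close> are represented by the total functions that vanish outside \<open>S\<close>.
  Scalars are complex, so that spectra are complex spectra.
\<close>

definition funs_on :: "'a set \<Rightarrow> ('a \<Rightarrow> complex) set" where
  "funs_on S = {f. \<forall>z. z \<notin> S \<longrightarrow> f z = 0}"

definition fscale :: "complex \<Rightarrow> ('a \<Rightarrow> complex) \<Rightarrow> 'a \<Rightarrow> complex" where
  "fscale c f = (\<lambda>z. c * f z)"

global_interpretation cfun: vector_space fscale
  by unfold_locales (auto simp: fscale_def fun_eq_iff algebra_simps)

definition eigenspace ::
    "'a set \<Rightarrow> (('a \<Rightarrow> complex) \<Rightarrow> 'a \<Rightarrow> complex) \<Rightarrow> complex \<Rightarrow> ('a \<Rightarrow> complex) set" where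
  "eigenspace S L \<mu> = {f \<in> funs_on S. L f = fscale \<mu> f}"

definition generalized_eigenspace ::
    "'a set \<Rightarrow> (('a \<Rightarrow> complex) \<Rightarrow> 'a \<Rightarrow> complex) \<Rightarrow> complex \<Rightarrow> ('a \<Rightarrow> complex) set" where
  "generalized_eigenspace S L \<mu> =
     {f \<in> funs_on S. \<exists>k::nat. ((\<lambda>g. L g - fscale \<mu> g) ^^ k) f = 0}"

definition eigenvector ::
    "'a set \<Rightarrow> (('a \<Rightarrow> complex) \<Rightarrow> 'a \<Rightarrow> complex) \<Rightarrow> complex \<Rightarrow> ('a \<Rightarrow> complex) \<Rightarrow> bool" where
  "eigenvector S L \<mu> f \<longleftrightarrow> f \<in> eigenspace S L \<mu> \<and> f \<noteq> 0"

definition spec :: "'a set \<Rightarrow> (('a \<Rightarrow> complex) \<Rightarrow> 'a \<Rightarrow> complex) \<Rightarrow> complex set" where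
  "spec S L = {\<mu>. \<exists>f. eigenvector S L \<mu> f}"

definition geometric_multiplicity ::
    "'a set \<Rightarrow> (('a \<Rightarrow> complex) \<Rightarrow> 'a \<Rightarrow> complex) \<Rightarrow> complex \<Rightarrow> nat" where
  "geometric_multiplicity S L \<mu> = cfun.dim (eigenspace S L \<mu>)"

definition algebraic_multiplicity ::
    "'a set \<Rightarrow> (('a \<Rightarrow> complex) \<Rightarrow> 'a \<Rightarrow> complex) \<Rightarrow> complex \<Rightarrow> nat" where
  "algebraic_multiplicity S L \<mu> = cfun.dim (generalized_eigenspace S L \<mu>)"

definition weighted_involution ::
    "'a set \<Rightarrow> ('a \<Rightarrow> 'a) \<Rightarrow> ('a \<Rightarrow> real) \<Rightarrow> real \<Rightarrow> bool" where
  "weighted_involution S \<sigma> \<kappa> K \<longleftrightarrow> finite S \<and>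
     (\<forall>z\<in>S. \<sigma> z \<in> S \<and> \<sigma> (\<sigma> z) = z \<and> \<kappa> z > 0 \<and> \<kappa> z * \<kappa> (\<sigma> z) = K)"

definition R_op :: "'a set \<Rightarrow> ('a \<Rightarrow> 'a) \<Rightarrow> ('a \<Rightarrow> complex) \<Rightarrow> 'a \<Rightarrow> complex" where
  "R_op S \<sigma> f = (\<lambda>z. if z \<in> S then f (\<sigma> z) else 0)"

definition Delta_op :: "('a \<Rightarrow> real) \<Rightarrow> ('a \<Rightarrow> complex) \<Rightarrow> 'a \<Rightarrow> complex" where
  "Delta_op \<kappa> f = (\<lambda>z. complex_of_real (sqrt (\<kappa> z)) * f z)"

definition T_op ::
    "'a set \<Rightarrow> ('a \<Rightarrow> 'a) \<Rightarrow> ('a \<Rightarrow> real) \<Rightarrow> ('a \<Rightarrow> complex) \<Rightarrow> 'a \<Rightarrow> complex" where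
  "T_op S \<sigma> \<kappa> = (Delta_op \<kappa> ^^ 2) \<circ> R_op S \<sigma>"

definition normalized_T_op ::
    "'a set \<Rightarrow> ('a \<Rightarrow> 'a) \<Rightarrow> ('a \<Rightarrow> real) \<Rightarrow> real \<Rightarrow> ('a \<Rightarrow> complex) \<Rightarrow> 'a \<Rightarrow> complex" where
  "normalized_T_op S \<sigma> \<kappa> K f =
     fscale (complex_of_real (K powr (- 1 / 2))) (T_op S \<sigma> \<kappa> f)"

text \<open>
  A transition matrix restricted to \<open>S\<close>. Row sums may be smaller than one because the chain
  may leave \<open>S\<close> (absorption). The matrix acts on functions from the left, so its eigenvectors
  below are right eigenvectors.
\<close>

definition transition_matrix :: "'a set \<Rightarrow> ('a \<Rightarrow> 'a \<Rightarrow> real) \<Rightarrow> bool" where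
  "transition_matrix S P \<longleftrightarrow>
     (\<forall>x\<in>S. (\<forall>y\<in>S. P x y \<ge> 0) \<and> (\<Sum>y\<in>S. P x y) \<le> 1)"

definition matrix_op ::
    "'a set \<Rightarrow> ('a \<Rightarrow> 'a \<Rightarrow> real) \<Rightarrow> ('a \<Rightarrow> complex) \<Rightarrow> 'a \<Rightarrow> complex" where
  "matrix_op S P f = (\<lambda>x. if x \<in> S then \<Sum>y\<in>S. complex_of_real (P x y) * f y else 0)"

definition basis_on :: "'a set \<Rightarrow> nat set \<Rightarrow> (nat \<Rightarrow> 'a \<Rightarrow> complex) \<Rightarrow> bool" where
  "basis_on S I \<phi> \<longleftrightarrow>
     inj_on \<phi> I \<and> cfun.independent (\<phi> ` I) \<and> cfun.span (\<phi> ` I) = funs_on S"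

text \<open>
  \<open>\<phi>\<close> is a basis of eigenvectors of the transition matrix \<open>P\<close> that are also eigenvectors of
  \<open>T_op S \<sigma> \<kappa>\<close>, and \<open>\<epsilon>\<close> is the family of their signs.
\<close>

definition parity_basis ::
    "'a set \<Rightarrow> ('a \<Rightarrow> 'a) \<Rightarrow> ('a \<Rightarrow> real) \<Rightarrow> real \<Rightarrow> ('a \<Rightarrow> 'a \<Rightarrow> real) \<Rightarrow>
     (nat \<Rightarrow> 'a \<Rightarrow> complex) \<Rightarrow> (nat \<Rightarrow> real) \<Rightarrow> bool" where
  "parity_basis S \<sigma> \<kappa> K P \<phi> \<epsilon> \<longleftrightarrow>
     transition_matrix S P \<and> basis_on S {1..card S} \<phi> \<and>
     (\<forall>\<nu>\<in>{1..card S}. (\<exists>\<mu>. eigenvector S (matrix_op S P) \<mu> (\<phi> \<nu>)) \<and>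
        \<epsilon> \<nu> \<in> {1, -1} \<and>
        T_op S \<sigma> \<kappa> (\<phi> \<nu>) = fscale (complex_of_real (\<epsilon> \<nu> * sqrt K)) (\<phi> \<nu>))"

text \<open>The biased random walk on \<open>{0..a}\<close>, absorbed at \<open>0\<close> and \<open>a\<close>.\<close>

definition walk_matrix :: "nat \<Rightarrow> real \<Rightarrow> real \<Rightarrow> nat \<Rightarrow> nat \<Rightarrow> real" where
  "walk_matrix a p q x y =
     (if x = 0 \<or> x = a then (if y = x then 1 else 0)
      else if y = x + 1 then p else if y + 1 = x then q else 0)"

definition walk_states :: "nat \<Rightarrow> nat set" where
  "walk_states a = {1..a - 1}"

definition walk_sigma :: "nat \<Rightarrow> nat \<Rightarrow> nat" where
  "walk_sigma a z = a - z"

definition walk_kappa :: "nat \<Rightarrow> real \<Rightarrow> real \<Rightarrow> nat \<Rightarrow> real" where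
  "walk_kappa a p q z = (p / q) ^ (a - z)"

definition walk_K :: "nat \<Rightarrow> real \<Rightarrow> real \<Rightarrow> real" where
  "walk_K a p q = (p / q) ^ a"

definition walk_T :: "nat \<Rightarrow> real \<Rightarrow> real \<Rightarrow> (nat \<Rightarrow> complex) \<Rightarrow> nat \<Rightarrow> complex" where
  "walk_T a p q = T_op (walk_states a) (walk_sigma a) (walk_kappa a p q)"

definition walk_eigenvalue :: "nat \<Rightarrow> real \<Rightarrow> real \<Rightarrow> nat \<Rightarrow> real" where
  "walk_eigenvalue a p q \<nu> = 2 * sqrt (p * q) * cos (pi * real \<nu> / real a)"

text \<open>The eigenvectors of the walk are only determined up to the factors \<open>c \<nu>\<close>.\<close>

definition walk_phi ::
    "nat \<Rightarrow> real \<Rightarrow> real \<Rightarrow> (nat \<Rightarrow> complex) \<Rightarrow> nat \<Rightarrow> nat \<Rightarrow> complex" where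
  "walk_phi a p q c \<nu> = (\<lambda>z. if z \<in> walk_states a
     then c \<nu> * complex_of_real
            ((q / p) powr (real z / 2) * sin (pi * real \<nu> * real z / real a))
     else 0)"

definition walk_sign :: "nat \<Rightarrow> real" where
  "walk_sign \<nu> = (- 1) ^ (\<nu> + 1)"

end

theory Submission
  imports Defs
begin

text \<open>
  The weighted reflection \<open>T\<close> satisfies \<open>T (T f) z = \<kappa> z * \<kappa> (\<sigma> z) * f z = K * f z\<close>; hence every
  eigenvalue is a square root of \<open>K\<close>, and dividing \<open>T\<close> by \<open>sqrt K\<close> gives an involution.

  Once \<open>T\<close> is diagonal in a basis \<open>\<phi>\<close> with signs \<open>\<epsilon>\<close>, all spectral data can be read off the signs.
  For \<open>\<mu> = e * sqrt K\<close> the operator \<open>T + \<mu>\<close> kills the basis vectors of sign \<open>- e\<close>, multiplies those of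
  sign \<open>e\<close> by \<open>2 * \<mu>\<close>, and acts as \<open>2 * \<mu>\<close> on the eigenspace of \<open>\<mu>\<close>. So that eigenspace is spanned
  by the basis vectors of sign \<open>e\<close> (\<open>eigenspace_eq_span_parity\<close>), and its dimension counts them.
  Algebraic and geometric multiplicities agree because \<open>(T - \<mu>) * (T - \<mu>) = - 2 * \<mu> * (T - \<mu>)\<close>, which
  rules out nontrivial Jordan blocks (\<open>generalized_eigenspace_T_op\<close>).

  For the walk, the factor \<open>(q / p) powr (z / 2)\<close> turns the asymmetric recursion into the symmetric one
  \<open>sin (\<theta> * (z + 1)) + sin (\<theta> * (z - 1)) = 2 * cos \<theta> * sin (\<theta> * z)\<close>, and \<open>\<theta> = pi * \<nu> / a\<close> makes the
  sine vanish at both absorbing states (\<open>walk_phi_eigenvector\<close>). Cosine is injective on \<open>[0, pi]\<close>, so the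
  \<open>a - 1\<close> eigenvalues are distinct and the eigenvectors form a basis (\<open>walk_basis\<close>). The sign of
  mode \<open>\<nu>\<close> comes from \<open>sin (pi * \<nu> - x) = (- 1) ^ (\<nu> + 1) * sin x\<close> (\<open>walk_T_phi\<close>); the multiplicities
  are thus the numbers of odd and of even \<open>\<nu>\<close> in \<open>{1..a - 1}\<close>.

  The parity decomposition can be trivial: take \<open>\<sigma> = id\<close> and \<open>\<kappa> = sqrt K\<close>, so that \<open>T\<close> is scalar.
\<close>

section \<open>Bases of function spaces on finite sets\<close>

lemma sum_fscale_apply: "(\<Sum>x\<in>A. fscale (u x) (g x)) z = (\<Sum>x\<in>A. u x * g x z)"
  by (induction A rule: infinite_finite_induct) (auto simp: fscale_def)

lemma funs_on_subspace: "cfun.subspace (funs_on S)"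
  by (auto simp: cfun.subspace_def funs_on_def fscale_def)

definition point_fun :: "'a \<Rightarrow> 'a \<Rightarrow> complex" where
  "point_fun s = (\<lambda>z. if z = s then 1 else 0)"

lemma inj_point_fun: "inj point_fun"
  by (rule injI) (metis point_fun_def zero_neq_one)

lemma point_fun_in_funs_on: "s \<in> S \<Longrightarrow> point_fun s \<in> funs_on S"
  by (auto simp: point_fun_def funs_on_def)

lemma span_point_fun:
  assumes "finite S"
  shows "cfun.span (point_fun ` S) = funs_on S"
proof
  show "cfun.span (point_fun ` S) \<subseteq> funs_on S"
    by (intro cfun.span_minimal funs_on_subspace) (auto intro: point_fun_in_funs_on)
  show "funs_on S \<subseteq> cfun.span (point_fun ` S)"
  proof
    fix f assume f: "f \<in> funs_on S"
    have "f = (\<Sum>s\<in>S. fscale (f s) (point_fun s))"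
      using assms f
      by (auto simp: fun_eq_iff sum_fscale_apply point_fun_def funs_on_def if_distrib sum.delta cong: if_cong)
    also have "\<dots> \<in> cfun.span (point_fun ` S)"
      by (intro cfun.span_sum cfun.span_scale cfun.span_base imageI)
    finally show "f \<in> cfun.span (point_fun ` S)" .
  qed
qed

lemma independent_point_fun:
  assumes "finite S"
  shows "cfun.independent (point_fun ` S)"
proof (rule cfun.independent_if_scalars_zero)
  show "finite (point_fun ` S)" using assms by simp
  fix u f assume 0: "(\<Sum>f\<in>point_fun ` S. fscale (u f) f) = 0" and f: "f \<in> point_fun ` S"
  then obtain s where s: "s \<in> S" "f = point_fun s" by blast
  have "(\<Sum>f\<in>point_fun ` S. fscale (u f) f) s = (\<Sum>t\<in>S. u (point_fun t) * point_fun t s)"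
    unfolding sum_fscale_apply
    by (subst sum.reindex) (auto intro: inj_on_subset[OF inj_point_fun])
  also have "\<dots> = u f"
    using assms s by (simp add: point_fun_def if_distrib sum.delta' cong: if_cong)
  finally show "u f = 0" using 0 by simp
qed

text \<open>
  A vector outside the span of \<open>B\<close> would extend \<open>B\<close> to an independent set of size \<open>card S + 1\<close>,
  although the point functions span with \<open>card S\<close> elements.
\<close>
lemma independent_spans_funs_on:
  assumes "finite S" and ind: "cfun.independent B" and sub: "B \<subseteq> funs_on S"
    and card: "card B = card S"
  shows "cfun.span B = funs_on S"
proof
  show "cfun.span B \<subseteq> funs_on S" by (intro cfun.span_minimal sub funs_on_subspace)
  have bound: "finite C \<and> card C \<le> card S" if "cfun.independent C" "C \<subseteq> funs_on S" for C
  proof -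
    have "finite C \<and> card C \<le> card (point_fun ` S)"
      using that \<open>finite S\<close> by (intro cfun.independent_span_bound) (auto simp: span_point_fun)
    then show ?thesis using card_image_le[OF \<open>finite S\<close>, of point_fun] by linarith
  qed
  show "funs_on S \<subseteq> cfun.span B"
  proof (rule subsetI, rule ccontr)
    fix f assume f: "f \<in> funs_on S" "f \<notin> cfun.span B"
    then have "card (insert f B) \<le> card S"
      using bound[of "insert f B"] ind sub by (simp add: cfun.independent_insert)
    moreover have "f \<notin> B" "finite B" using f cfun.span_base bound[OF ind sub] by auto
    ultimately show False using card by simp
  qed
qed

text \<open>
  If a further eigenvector \<open>x\<close> is a combination of \<open>B\<close>, then applying \<open>L - m x\<close> multiplies each
  coefficient by the nonzero number \<open>m b - m x\<close> and gives the zero vector, so all coefficients vanish.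
\<close>
lemma independent_eigenvectors:
  assumes lin: "Vector_Spaces.linear fscale fscale L"
    and "finite B" "0 \<notin> B" "inj_on m B" "\<And>b. b \<in> B \<Longrightarrow> L b = fscale (m b) b"
  shows "cfun.independent B"
  using assms(2-)
proof (induction B rule: finite_induct)
  case empty
  show ?case by (rule cfun.independent_empty)
next
  case (insert x B)
  interpret L: Vector_Spaces.linear fscale fscale L by (fact lin)
  have ind: "cfun.independent B" using insert by auto
  have "x \<notin> cfun.span B"
  proof
    assume "x \<in> cfun.span B"
    then obtain u where x: "x = (\<Sum>b\<in>B. fscale (u b) b)"
      using insert.hyps by (auto simp: cfun.span_finite)
    have "0 = L x - fscale (m x) x" using insert.prems(3)[of x] by simp
    also have "L x = (\<Sum>b\<in>B. fscale (u b) (L b))"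
      by (subst x) (simp add: L.sum L.scale)
    also have "\<dots> = (\<Sum>b\<in>B. fscale (u b * m b) b)"
      using insert.prems(3) by (intro sum.cong) auto
    also have "fscale (m x) x = (\<Sum>b\<in>B. fscale (m x * u b) b)"
      using arg_cong[OF x, of "fscale (m x)"] by (simp only: cfun.scale_sum_right cfun.scale_scale)
    also have "(\<Sum>b\<in>B. fscale (u b * m b) b) - \<dots> = (\<Sum>b\<in>B. fscale ((m b - m x) * u b) b)"
      unfolding sum_subtractf[symmetric]
      by (intro sum.cong) (auto simp: fscale_def fun_eq_iff algebra_simps)
    finally have 0: "(\<Sum>b\<in>B. fscale ((m b - m x) * u b) b) = 0" by (rule sym)
    have "u b = 0" if b: "b \<in> B" for b
    proof -
      have "(m b - m x) * u b = 0"
        using cfun.independentD[OF ind insert.hyps(1) order.refl 0 b] .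
      moreover have "m b \<noteq> m x" using insert.prems(2) insert.hyps(2) b by (auto simp: inj_on_def)
      ultimately show ?thesis by simp
    qed
    then have "x = 0" by (subst x) simp
    then show False using insert.prems(1) by blast
  qed
  then show ?case using ind by (simp add: cfun.independent_insert)
qed

section \<open>The weighted reflection\<close>
lemma linear_matrix_op: "Vector_Spaces.linear fscale fscale (matrix_op S P)"
  by unfold_locales
     (auto simp: matrix_op_def fscale_def fun_eq_iff algebra_simps sum.distrib sum_distrib_left)

lemma linear_T_op: "Vector_Spaces.linear fscale fscale (T_op S \<sigma> \<kappa>)"
  by unfold_locales
     (auto simp: T_op_def Delta_op_def R_op_def numeral_2_eq_2 fscale_def fun_eq_iff algebra_simps)

lemma weighted_involution_K_pos: "weighted_involution S \<sigma> \<kappa> K \<Longrightarrow> S \<noteq> {} \<Longrightarrow> K > 0"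
  unfolding weighted_involution_def by (metis all_not_in_conv mult_pos_pos)

lemma T_op_apply:
  assumes "weighted_involution S \<sigma> \<kappa> K"
  shows "T_op S \<sigma> \<kappa> f z = (if z \<in> S then complex_of_real (\<kappa> z) * f (\<sigma> z) else 0)"
proof (cases "z \<in> S")
  case True
  then have "\<kappa> z > 0" using assms by (auto simp: weighted_involution_def)
  then have "complex_of_real (sqrt (\<kappa> z)) * complex_of_real (sqrt (\<kappa> z)) = complex_of_real (\<kappa> z)"
    by (simp flip: of_real_mult)
  then show ?thesis
    using True by (simp add: T_op_def Delta_op_def R_op_def numeral_2_eq_2 mult.assoc[symmetric])
qed (simp add: T_op_def Delta_op_def R_op_def numeral_2_eq_2)

lemma T_op_square:
  assumes "weighted_involution S \<sigma> \<kappa> K" and "f \<in> funs_on S"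
  shows "T_op S \<sigma> \<kappa> (T_op S \<sigma> \<kappa> f) = fscale (complex_of_real K) f"
  using assms
  by (auto simp: fun_eq_iff T_op_apply[OF assms(1)] weighted_involution_def funs_on_def fscale_def
           mult.assoc[symmetric] simp flip: of_real_mult)

lemma spec_T_op_subset:
  assumes w: "weighted_involution S \<sigma> \<kappa> K"
  shows "spec S (T_op S \<sigma> \<kappa>) \<subseteq> {complex_of_real (sqrt K), - complex_of_real (sqrt K)}"
proof
  fix \<mu> assume "\<mu> \<in> spec S (T_op S \<sigma> \<kappa>)"
  then obtain f where f: "f \<in> funs_on S" "T_op S \<sigma> \<kappa> f = fscale \<mu> f" "f \<noteq> 0"
    by (auto simp: spec_def eigenvector_def eigenspace_def)
  interpret T: Vector_Spaces.linear fscale fscale "T_op S \<sigma> \<kappa>" by (rule linear_T_op)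
  have "S \<noteq> {}" using f by (auto simp: funs_on_def fun_eq_iff)
  then have "K > 0" using weighted_involution_K_pos[OF w] by simp
  have "fscale (\<mu> * \<mu>) f = fscale (complex_of_real K) f"
    using T_op_square[OF w f(1)] by (simp add: f(2) T.scale)
  then have "\<mu> * \<mu> = complex_of_real K"
    using f(3) by (simp add: cfun.scale_cancel_right)
  also have "\<dots> = complex_of_real (sqrt K) * complex_of_real (sqrt K)"
    using \<open>K > 0\<close> by (simp flip: of_real_mult)
  finally show "\<mu> \<in> {complex_of_real (sqrt K), - complex_of_real (sqrt K)}"
    by (simp add: square_eq_iff)
qed

lemma normalized_T_op_involution:
  assumes w: "weighted_involution S \<sigma> \<kappa> K" and f: "f \<in> funs_on S"
  shows "normalized_T_op S \<sigma> \<kappa> K (normalized_T_op S \<sigma> \<kappa> K f) = f"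
proof (cases "S = {}")
  case True
  show ?thesis
  proof
    fix z show "normalized_T_op S \<sigma> \<kappa> K (normalized_T_op S \<sigma> \<kappa> K f) z = f z"
      using f True unfolding normalized_T_op_def fscale_def T_op_apply[OF w] by (simp add: funs_on_def)
  qed
next
  case False
  interpret T: Vector_Spaces.linear fscale fscale "T_op S \<sigma> \<kappa>" by (rule linear_T_op)
  have "K > 0" using weighted_involution_K_pos[OF w False] .
  then have "K powr (- 1 / 2) * K powr (- 1 / 2) * K powr 1 = 1"
    unfolding powr_add[symmetric] by simp
  then have "K powr (- 1 / 2) * (K powr (- 1 / 2) * K) = 1"
    using \<open>K > 0\<close> by (simp add: mult.assoc)
  then have "fscale (complex_of_real (K powr (- 1 / 2) * (K powr (- 1 / 2) * K))) f = f"
    by (simp only: of_real_1 cfun.scale_one)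
  then show ?thesis
    by (simp add: normalized_T_op_def T.scale T_op_square[OF w f] flip: of_real_mult)
qed

text \<open>
  Write \<open>N = T - \<mu>\<close>. From \<open>T\<^sup>2 = K = \<mu>\<^sup>2\<close> follows \<open>N\<^sup>2 = - 2 * \<mu> * N\<close>, so every positive power of \<open>N\<close> is a
  nonzero multiple of \<open>N\<close> and has the same kernel.
\<close>
lemma generalized_eigenspace_T_op:
  assumes w: "weighted_involution S \<sigma> \<kappa> K"
    and \<mu>: "\<mu> * \<mu> = complex_of_real K" "\<mu> \<noteq> 0"
  shows "generalized_eigenspace S (T_op S \<sigma> \<kappa>) \<mu> = eigenspace S (T_op S \<sigma> \<kappa>) \<mu>"
proof -
  let ?T = "T_op S \<sigma> \<kappa>"
  define N where "N = (\<lambda>g. ?T g - fscale \<mu> g)"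
  interpret T: Vector_Spaces.linear fscale fscale ?T by (rule linear_T_op)
  have sq: "N (N f) = fscale (- 2 * \<mu>) (N f)" if "f \<in> funs_on S" for f
    unfolding N_def
    by (simp add: T.diff T.scale T_op_square[OF w that] \<mu>(1)[symmetric])
       (simp add: fscale_def fun_eq_iff algebra_simps)
  have N_scale: "N (fscale c f) = fscale c (N f)" for c f
    unfolding N_def by (simp add: T.scale) (simp add: fscale_def fun_eq_iff algebra_simps)
  have pow: "(N ^^ Suc k) f = fscale ((- 2 * \<mu>) ^ k) (N f)" if "f \<in> funs_on S" for f k
  proof (induction k)
    case (Suc k)
    have "(N ^^ Suc (Suc k)) f = N (fscale ((- 2 * \<mu>) ^ k) (N f))" using Suc by simp
    also have "\<dots> = fscale ((- 2 * \<mu>) ^ Suc k) (N f)"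
      unfolding N_scale sq[OF that] by (simp only: cfun.scale_scale power_Suc mult.commute)
    finally show ?case .
  qed simp
  have "N f = 0" if f: "f \<in> funs_on S" and k: "(N ^^ k) f = 0" for f k
  proof (cases k)
    case 0
    then show ?thesis using k N_scale[of 0 f] by simp
  next
    case (Suc j)
    then have "fscale ((- 2 * \<mu>) ^ j) (N f) = 0" using k pow[OF f] by simp
    then show ?thesis using \<mu>(2) by (simp add: cfun.scale_eq_0_iff)
  qed
  moreover have "\<exists>k. (N ^^ k) f = 0" if "N f = 0" for f
    by (rule exI[of _ 1]) (simp add: that)
  ultimately have "generalized_eigenspace S ?T \<mu> = {f \<in> funs_on S. N f = 0}"
    unfolding generalized_eigenspace_def N_def[symmetric] by blast
  then show ?thesis by (simp add: eigenspace_def N_def)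
qed

text \<open>
  Up to the factor \<open>2 * \<mu>\<close>, the operator \<open>T + \<mu>\<close> is the projection onto the eigenspace of \<open>\<mu>\<close>. It maps
  each basis vector into the span of those with sign \<open>e\<close>, hence it maps every function there.
\<close>
lemma eigenspace_eq_span_parity:
  assumes w: "weighted_involution S \<sigma> \<kappa> K" and b: "parity_basis S \<sigma> \<kappa> K P \<phi> \<epsilon>"
    and ne: "S \<noteq> {}" and e: "e \<in> {1, -1}"
  shows "eigenspace S (T_op S \<sigma> \<kappa>) (complex_of_real (e * sqrt K)) =
         cfun.span (\<phi> ` {\<nu>\<in>{1..card S}. \<epsilon> \<nu> = e})" (is "?E = cfun.span ?B")
proof -
  let ?T = "T_op S \<sigma> \<kappa>" and ?\<mu> = "complex_of_real (e * sqrt K)"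
  interpret T: Vector_Spaces.linear fscale fscale ?T by (rule linear_T_op)
  have "K > 0" using weighted_involution_K_pos[OF w ne] .
  then have \<mu>0: "?\<mu> \<noteq> 0" using e by auto
  have span: "cfun.span (\<phi> ` {1..card S}) = funs_on S"
    using b by (simp add: parity_basis_def basis_on_def)
  have eig: "?T (\<phi> \<nu>) = fscale (complex_of_real (\<epsilon> \<nu> * sqrt K)) (\<phi> \<nu>)" "\<epsilon> \<nu> \<in> {1, -1}"
    if "\<nu> \<in> {1..card S}" for \<nu>
    using b that by (auto simp: parity_basis_def)
  have sub: "cfun.subspace ?E"
    using funs_on_subspace[of S]
    by (auto simp: cfun.subspace_def eigenspace_def T.add T.scale)
       (simp_all add: fscale_def fun_eq_iff algebra_simps)
  show ?thesis
  proof
    show "cfun.span ?B \<subseteq> ?E"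
    proof (rule cfun.span_minimal[OF _ sub], rule subsetI)
      fix f assume "f \<in> ?B"
      then obtain \<nu> where "\<nu> \<in> {1..card S}" "\<epsilon> \<nu> = e" "f = \<phi> \<nu>" by blast
      then show "f \<in> ?E"
        using eig(1) span cfun.span_base[of f "\<phi> ` {1..card S}"] by (auto simp: eigenspace_def)
    qed
    have proj: "?T f + fscale ?\<mu> f \<in> cfun.span ?B" if "f \<in> funs_on S" for f
      using that unfolding span[symmetric]
    proof (induction f rule: cfun.span_induct_alt)
      case base
      show ?case unfolding T.zero cfun.scale_zero_right add_0 by (rule cfun.span_zero)
    next
      case (step c f g)
      then obtain \<nu> where \<nu>: "\<nu> \<in> {1..card S}" "f = \<phi> \<nu>" by blast
      have "?T f + fscale ?\<mu> f \<in> cfun.span ?B"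
      proof (cases "\<epsilon> \<nu> = e")
        case True
        then have "f \<in> cfun.span ?B" using \<nu> by (auto intro: cfun.span_base)
        then show ?thesis
          using eig(1)[OF \<nu>(1)] \<nu>(2) by (auto intro: cfun.span_add cfun.span_scale)
      next
        case False
        then have "\<epsilon> \<nu> = - e" using eig(2)[OF \<nu>(1)] e by auto
        then have "?T f + fscale ?\<mu> f = 0"
          unfolding \<nu>(2) eig(1)[OF \<nu>(1)] by (simp add: fscale_def fun_eq_iff)
        then show ?thesis by (simp add: cfun.span_zero)
      qed
      then have "fscale c (?T f + fscale ?\<mu> f) + (?T g + fscale ?\<mu> g) \<in> cfun.span ?B"
        by (rule cfun.span_add[OF cfun.span_scale step(2)])
      moreover have "fscale c (?T f + fscale ?\<mu> f) + (?T g + fscale ?\<mu> g) =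
                     ?T (fscale c f + g) + fscale ?\<mu> (fscale c f + g)"
        by (simp add: T.add T.scale) (simp add: fscale_def fun_eq_iff algebra_simps)
      ultimately show ?case by (simp only:)
    qed
    show "?E \<subseteq> cfun.span ?B"
    proof
      fix f assume "f \<in> ?E"
      then have f: "f \<in> funs_on S" "?T f = fscale ?\<mu> f" by (auto simp: eigenspace_def)
      have "f = fscale (inverse (2 * ?\<mu>)) (?T f + fscale ?\<mu> f)"
        unfolding f(2) using \<mu>0 by (auto simp: fscale_def fun_eq_iff field_simps)
      also have "\<dots> \<in> cfun.span ?B" using proj[OF f(1)] by (rule cfun.span_scale)
      finally show "f \<in> cfun.span ?B" .
    qed
  qed
qed

lemma dim_parity_eigenspace:
  assumes w: "weighted_involution S \<sigma> \<kappa> K" and b: "parity_basis S \<sigma> \<kappa> K P \<phi> \<epsilon>"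
    and ne: "S \<noteq> {}" and e: "e \<in> {1, -1}"
  shows "cfun.dim (eigenspace S (T_op S \<sigma> \<kappa>) (complex_of_real (e * sqrt K))) =
         card {\<nu>\<in>{1..card S}. \<epsilon> \<nu> = e}"
proof -
  let ?J = "{\<nu>\<in>{1..card S}. \<epsilon> \<nu> = e}"
  have inj: "inj_on \<phi> {1..card S}" and ind: "cfun.independent (\<phi> ` {1..card S})"
    using b by (auto simp: parity_basis_def basis_on_def)
  have ind': "cfun.independent (\<phi> ` ?J)" by (rule cfun.independent_mono[OF ind]) auto
  have "cfun.dim (eigenspace S (T_op S \<sigma> \<kappa>) (complex_of_real (e * sqrt K))) = card (\<phi> ` ?J)"
    unfolding eigenspace_eq_span_parity[OF assms] by (rule cfun.dim_span_eq_card_independent[OF ind'])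
  also have "\<dots> = card ?J" by (rule card_image, rule inj_on_subset[OF inj]) auto
  finally show ?thesis .
qed

lemma spec_parity:
  assumes w: "weighted_involution S \<sigma> \<kappa> K" and b: "parity_basis S \<sigma> \<kappa> K P \<phi> \<epsilon>"
    and ne: "S \<noteq> {}"
  shows "spec S (T_op S \<sigma> \<kappa>) = (\<lambda>\<nu>. complex_of_real (\<epsilon> \<nu> * sqrt K)) ` {1..card S}"
proof
  let ?T = "T_op S \<sigma> \<kappa>"
  have ind: "cfun.independent (\<phi> ` {1..card S})" and span: "cfun.span (\<phi> ` {1..card S}) = funs_on S"
    using b by (auto simp: parity_basis_def basis_on_def)
  show "(\<lambda>\<nu>. complex_of_real (\<epsilon> \<nu> * sqrt K)) ` {1..card S} \<subseteq> spec S ?T"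
  proof
    fix \<mu> assume "\<mu> \<in> (\<lambda>\<nu>. complex_of_real (\<epsilon> \<nu> * sqrt K)) ` {1..card S}"
    then obtain \<nu> where \<nu>: "\<nu> \<in> {1..card S}" "\<mu> = complex_of_real (\<epsilon> \<nu> * sqrt K)" by blast
    have "?T (\<phi> \<nu>) = fscale \<mu> (\<phi> \<nu>)" using b \<nu> by (auto simp: parity_basis_def)
    moreover have "\<phi> \<nu> \<in> funs_on S" using \<nu> span cfun.span_base by blast
    moreover have "\<phi> \<nu> \<noteq> 0" using ind \<nu> cfun.dependent_zero by (metis imageI)
    ultimately show "\<mu> \<in> spec S ?T" by (auto simp: spec_def eigenvector_def eigenspace_def)
  qed
  show "spec S ?T \<subseteq> (\<lambda>\<nu>. complex_of_real (\<epsilon> \<nu> * sqrt K)) ` {1..card S}"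
  proof
    fix \<mu> assume \<mu>: "\<mu> \<in> spec S ?T"
    then have "\<mu> \<in> {complex_of_real (sqrt K), - complex_of_real (sqrt K)}"
      using spec_T_op_subset[OF w] by blast
    then obtain e :: real where e: "e \<in> {1, -1}" "\<mu> = complex_of_real (e * sqrt K)"
      by (elim insertE emptyE) (auto intro: that[of 1] that[of "-1"])
    have "{\<nu>\<in>{1..card S}. \<epsilon> \<nu> = e} \<noteq> {}"
    proof
      assume none: "{\<nu>\<in>{1..card S}. \<epsilon> \<nu> = e} = {}"
      have "eigenspace S ?T \<mu> = {0}"
        unfolding e(2) eigenspace_eq_span_parity[OF w b ne e(1)] none by simp
      then show False using \<mu> by (auto simp: spec_def eigenvector_def)
    qed
    then show "\<mu> \<in> (\<lambda>\<nu>. complex_of_real (\<epsilon> \<nu> * sqrt K)) ` {1..card S}" using e(2) by blast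
  qed
qed

text \<open>
  With \<open>\<sigma> = id\<close> and constant weight \<open>sqrt K\<close> the operator is \<open>sqrt K\<close> times the identity. The chain
  that never moves has the point functions as eigenvectors.
\<close>
lemma trivial_parity_exists:
  assumes "finite S" and "K > 0"
  shows "\<exists>\<sigma> \<kappa> P \<phi> \<epsilon>. weighted_involution S \<sigma> \<kappa> K \<and> parity_basis S \<sigma> \<kappa> K P \<phi> \<epsilon> \<and>
           (\<forall>\<nu>\<in>{1..card S}. \<epsilon> \<nu> = 1)"
proof -
  let ?P = "\<lambda>x y. if x = y then 1 else (0::real)"
  let ?\<kappa> = "\<lambda>_::'a. sqrt K"
  have w: "weighted_involution S id ?\<kappa> K"
    using assms by (simp add: weighted_involution_def)
  obtain h where h: "bij_betw h {1..card S} S"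
    using ex_bij_betw_nat_finite_1[OF \<open>finite S\<close>] by blast
  define \<phi> where "\<phi> = point_fun \<circ> h"
  have img: "\<phi> ` {1..card S} = point_fun ` S"
    using h unfolding \<phi>_def image_comp[symmetric] by (simp add: bij_betw_def)
  have basis: "basis_on S {1..card S} \<phi>"
    unfolding basis_on_def img span_point_fun[OF \<open>finite S\<close>]
    using h independent_point_fun[OF \<open>finite S\<close>]
    by (auto simp: \<phi>_def bij_betw_def intro: comp_inj_on inj_on_subset[OF inj_point_fun])
  have P: "transition_matrix S ?P"
    using \<open>finite S\<close> by (auto simp: transition_matrix_def)
  have Pf: "matrix_op S ?P f = fscale 1 f" if "f \<in> funs_on S" for f
    using that \<open>finite S\<close>
    by (auto simp: matrix_op_def funs_on_def fscale_def fun_eq_iff if_distrib if_distribR cong: if_cong)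
  have Tf: "T_op S id ?\<kappa> f = fscale (complex_of_real (1 * sqrt K)) f" if "f \<in> funs_on S" for f
    using that by (auto simp: T_op_apply[OF w] funs_on_def fscale_def fun_eq_iff)
  have \<phi>: "\<phi> \<nu> \<in> funs_on S" "\<phi> \<nu> \<noteq> 0" if "\<nu> \<in> {1..card S}" for \<nu>
  proof -
    show "\<phi> \<nu> \<in> funs_on S"
      using that h by (auto simp: \<phi>_def bij_betw_def intro!: point_fun_in_funs_on)
    show "\<phi> \<nu> \<noteq> 0" by (auto simp: \<phi>_def point_fun_def fun_eq_iff)
  qed
  have "parity_basis S id ?\<kappa> K ?P \<phi> (\<lambda>_. 1)"
    unfolding parity_basis_def
  proof (intro conjI ballI)
    fix \<nu> assume "\<nu> \<in> {1..card S}"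
    note \<nu> = \<phi>[OF this]
    show "\<exists>\<mu>. eigenvector S (matrix_op S ?P) \<mu> (\<phi> \<nu>)"
      using \<nu> Pf by (intro exI[of _ 1]) (simp add: eigenvector_def eigenspace_def)
    show "T_op S id ?\<kappa> (\<phi> \<nu>) = fscale (complex_of_real (1 * sqrt K)) (\<phi> \<nu>)" using Tf \<nu> by blast
  qed (use P basis in auto)
  with w show ?thesis by blast
qed

section \<open>The biased random walk\<close>
lemma walk_weighted_involution:
  assumes "p > 0" "q > 0"
  shows "weighted_involution (walk_states a) (walk_sigma a) (walk_kappa a p q) (walk_K a p q)"
  using assms
  by (auto simp: weighted_involution_def walk_states_def walk_sigma_def walk_kappa_def walk_K_def
           simp flip: power_add)

lemma walk_transition_matrix:
  assumes "p > 0" "q > 0" "p + q = 1"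
  shows "transition_matrix (walk_states a) (walk_matrix a p q)"
  unfolding transition_matrix_def
proof (intro ballI conjI)
  fix x assume x: "x \<in> walk_states a"
  show "walk_matrix a p q x y \<ge> 0" for y using assms by (simp add: walk_matrix_def)
  have "(\<Sum>y\<in>walk_states a. walk_matrix a p q x y) =
        (\<Sum>y\<in>walk_states a. (if y = x + 1 then p else 0) + (if y = x - 1 then q else 0))"
    using x by (intro sum.cong) (auto simp: walk_matrix_def walk_states_def)
  also have "\<dots> \<le> p + q"
    using assms by (simp add: sum.distrib sum.delta walk_states_def)
  finally show "(\<Sum>y\<in>walk_states a. walk_matrix a p q x y) \<le> 1" using assms by simp
qed

lemma walk_matrix_op:
  assumes "f \<in> funs_on (walk_states a)" and x: "x \<in> walk_states a"
  shows "matrix_op (walk_states a) (walk_matrix a p q) f x =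
         complex_of_real p * f (x + 1) + complex_of_real q * f (x - 1)"
proof -
  have "matrix_op (walk_states a) (walk_matrix a p q) f x =
        (\<Sum>y\<in>walk_states a. (if y = x + 1 then complex_of_real p * f (x + 1) else 0) +
                             (if y = x - 1 then complex_of_real q * f (x - 1) else 0))"
    using x unfolding matrix_op_def if_P[OF x]
    by (intro sum.cong) (auto simp: walk_matrix_def walk_states_def)
  also have "\<dots> = complex_of_real p * f (x + 1) + complex_of_real q * f (x - 1)"
    using assms(1) by (auto simp: sum.distrib sum.delta walk_states_def funs_on_def)
  finally show ?thesis .
qed

lemma walk_phi_in_funs_on: "walk_phi a p q c \<nu> \<in> funs_on (walk_states a)"
  by (simp add: walk_phi_def funs_on_def)

text \<open>
  The sine vanishes at the two absorbing states, so the formula stays valid there. This lets the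
  states next to the boundary be treated like the interior ones.
\<close>
lemma walk_phi_closed_form:
  assumes "a > 0" "z \<le> a"
  shows "walk_phi a p q c \<nu> z =
    c \<nu> * complex_of_real ((q / p) powr (real z / 2) * sin (pi * real \<nu> * real z / real a))"
proof (cases "z \<in> walk_states a")
  case False
  then have "z = 0 \<or> z = a" using assms by (auto simp: walk_states_def)
  then have "sin (pi * real \<nu> * real z / real a) = 0"
    using assms sin_npi[of \<nu>] by (auto simp: mult.commute)
  then show ?thesis using False by (simp add: walk_phi_def)
qed (simp add: walk_phi_def)

lemma walk_phi_nonzero:
  assumes "p > 0" "q > 0" "\<nu> \<in> {1..a - 1}" "c \<nu> \<noteq> 0"
  shows "walk_phi a p q c \<nu> \<noteq> 0"
proof -
  have "0 < pi * real \<nu> / real a" "pi * real \<nu> / real a < pi"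
    using assms by (auto simp: field_simps)
  then have "sin (pi * real \<nu> / real a) > 0" by (rule sin_gt_zero)
  then have "walk_phi a p q c \<nu> 1 \<noteq> 0"
    using assms by (subst walk_phi_closed_form) auto
  then show ?thesis by (auto simp: fun_eq_iff)
qed

text \<open>
  Shifting \<open>z\<close> by one changes \<open>(q / p) powr (z / 2)\<close> by \<open>sqrt (q / p)\<close>, and
  \<open>p * sqrt (q / p) = q * sqrt (p / q) = sqrt (p * q)\<close>: after this conjugation both steps have the same
  weight, and the addition theorems for the sine apply.
\<close>
lemma walk_phi_eigenvector:
  assumes pq: "p > 0" "q > 0" and \<nu>: "\<nu> \<in> {1..a - 1}" and c: "c \<nu> \<noteq> 0"
  shows "eigenvector (walk_states a) (matrix_op (walk_states a) (walk_matrix a p q))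
           (complex_of_real (walk_eigenvalue a p q \<nu>)) (walk_phi a p q c \<nu>)"
proof -
  define \<theta> where "\<theta> = pi * real \<nu> / real a"
  define g where "g z = (q / p) powr (z / 2) * sin (\<theta> * z)" for z :: real
  have a: "a > 0" using \<nu> by auto
  have phi: "walk_phi a p q c \<nu> z = c \<nu> * complex_of_real (g (real z))" if "z \<le> a" for z
    using walk_phi_closed_form[OF a that] by (simp add: g_def \<theta>_def)
  have up: "p * (q / p) powr ((z + 1) / 2) = sqrt (p * q) * (q / p) powr (z / 2)" for z
  proof -
    have "p * (q / p) powr (1 / 2) = sqrt (p * q)"
      using pq by (simp add: powr_half_sqrt real_sqrt_divide real_sqrt_mult field_simps)
    then show ?thesis by (simp add: add_divide_distrib powr_add mult_ac)
  qed
  have down: "q * (q / p) powr ((z - 1) / 2) = sqrt (p * q) * (q / p) powr (z / 2)" for z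
  proof -
    have "q / (q / p) powr (1 / 2) = sqrt (p * q)"
      using pq by (simp add: powr_half_sqrt real_sqrt_divide real_sqrt_mult field_simps)
    then show ?thesis by (simp add: diff_divide_distrib powr_diff flip: times_divide_eq_left)
  qed
  have rec: "p * g (z + 1) + q * g (z - 1) = walk_eigenvalue a p q \<nu> * g z" for z
  proof -
    have "p * g (z + 1) + q * g (z - 1) =
          sqrt (p * q) * (q / p) powr (z / 2) * (sin (\<theta> * z + \<theta>) + sin (\<theta> * z - \<theta>))"
      unfolding g_def mult.assoc[symmetric] up down by (simp add: algebra_simps)
    also have "\<dots> = walk_eigenvalue a p q \<nu> * g z"
      by (simp add: sin_add sin_diff walk_eigenvalue_def g_def \<theta>_def)
    finally show ?thesis .
  qed
  have "matrix_op (walk_states a) (walk_matrix a p q) (walk_phi a p q c \<nu>) x =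
        complex_of_real (walk_eigenvalue a p q \<nu>) * walk_phi a p q c \<nu> x" for x
  proof (cases "x \<in> walk_states a")
    case True
    then have x: "1 \<le> x" "x + 1 \<le> a" by (auto simp: walk_states_def)
    have "matrix_op (walk_states a) (walk_matrix a p q) (walk_phi a p q c \<nu>) x =
          c \<nu> * complex_of_real (p * g (real x + 1) + q * g (real x - 1))"
      using x by (simp add: walk_matrix_op[OF walk_phi_in_funs_on True] phi of_nat_diff algebra_simps)
    also have "\<dots> = complex_of_real (walk_eigenvalue a p q \<nu>) * walk_phi a p q c \<nu> x"
      unfolding rec using x by (simp add: phi)
    finally show ?thesis .
  qed (simp add: matrix_op_def walk_phi_def)
  then show ?thesis
    using walk_phi_in_funs_on walk_phi_nonzero[of p q \<nu> a c, OF pq \<nu> c]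
    by (simp add: eigenvector_def eigenspace_def fscale_def fun_eq_iff)
qed

lemma inj_on_walk_eigenvalue:
  assumes "p > 0" "q > 0"
  shows "inj_on (walk_eigenvalue a p q) {1..a - 1}"
proof
  fix \<nu> \<nu>' assume *: "\<nu> \<in> {1..a - 1}" "\<nu>' \<in> {1..a - 1}"
    and "walk_eigenvalue a p q \<nu> = walk_eigenvalue a p q \<nu>'"
  then have cos: "cos (pi * real \<nu> / real a) = cos (pi * real \<nu>' / real a)"
    using assms by (simp add: walk_eigenvalue_def)
  have "0 \<le> pi * real \<mu> / real a \<and> pi * real \<mu> / real a \<le> pi" if "\<mu> \<in> {1..a - 1}" for \<mu>
    using that by (auto simp: field_simps)
  with * have "pi * real \<nu> / real a = pi * real \<nu>' / real a"
    by (blast intro: cos_inj_pi cos)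
  moreover have "a \<noteq> 0" using * by auto
  ultimately show "\<nu> = \<nu>'" by simp
qed

text \<open>
  With \<open>r = p / q\<close> the powers of \<open>r\<close> combine as \<open>(a - z) - (a - z) / 2 = a / 2 - z / 2\<close>, which
  leaves \<open>r powr (a / 2) = sqrt K\<close> times the weight of \<open>\<phi> z\<close>; the sign comes from reflecting the sine.
\<close>
lemma walk_T_phi:
  assumes pq: "p > 0" "q > 0" and a: "a > 0"
  shows "T_op (walk_states a) (walk_sigma a) (walk_kappa a p q) (walk_phi a p q c \<nu>) =
         fscale (complex_of_real (walk_sign \<nu> * sqrt (walk_K a p q))) (walk_phi a p q c \<nu>)"
proof
  fix z
  show "T_op (walk_states a) (walk_sigma a) (walk_kappa a p q) (walk_phi a p q c \<nu>) z =
        fscale (complex_of_real (walk_sign \<nu> * sqrt (walk_K a p q))) (walk_phi a p q c \<nu>) z"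
  proof (cases "z \<in> walk_states a")
    case True
    then have z: "z \<le> a" by (auto simp: walk_states_def)
    define r where "r = p / q"
    have r: "r > 0" "q / p = inverse r" using pq by (auto simp: r_def)
    have refl: "sin (pi * real \<nu> * real (a - z) / real a) =
                walk_sign \<nu> * sin (pi * real \<nu> * real z / real a)"
    proof -
      have "pi * real \<nu> * real (a - z) / real a = real \<nu> * pi - pi * real \<nu> * real z / real a"
        using z a by (simp add: of_nat_diff field_simps)
      then show ?thesis by (simp add: sin_diff walk_sign_def)
    qed
    have weight: "walk_kappa a p q z * (q / p) powr (real (a - z) / 2) =
                  sqrt (walk_K a p q) * (q / p) powr (real z / 2)"
    proof -
      have inv: "(q / p) powr x = r powr (- x)" for x
        using r by (simp add: powr_minus inverse_powr)
      have "walk_kappa a p q z = r powr real (a - z)"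
        using r by (simp add: walk_kappa_def r_def[symmetric] powr_realpow)
      then have "walk_kappa a p q z * (q / p) powr (real (a - z) / 2) =
            r powr (real (a - z) + - (real (a - z) / 2))"
        unfolding inv powr_add by simp
      also have "real (a - z) + - (real (a - z) / 2) = real a / 2 + - (real z / 2)"
        using z by (simp add: of_nat_diff field_simps)
      also have "r powr \<dots> = r powr (real a / 2) * (q / p) powr (real z / 2)"
        unfolding inv powr_add ..
      also have "r powr (real a / 2) = sqrt (walk_K a p q)"
        using r by (simp add: walk_K_def r_def[symmetric] powr_realpow[symmetric]
            powr_half_sqrt[symmetric] powr_powr)
      finally show ?thesis .
    qed
    have "T_op (walk_states a) (walk_sigma a) (walk_kappa a p q) (walk_phi a p q c \<nu>) z =
          c \<nu> * complex_of_real ((walk_kappa a p q z * (q / p) powr (real (a - z) / 2)) *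
                 sin (pi * real \<nu> * real (a - z) / real a))"
      using True by (simp add: T_op_apply[OF walk_weighted_involution[OF pq]] walk_sigma_def
          walk_phi_closed_form[OF a])
    then show ?thesis
      unfolding weight refl by (simp add: fscale_def walk_phi_closed_form[OF a z])
  qed (simp add: T_op_apply[OF walk_weighted_involution[OF pq]] fscale_def walk_phi_def)
qed

lemma walk_basis:
  assumes pq: "p > 0" "q > 0" and c: "\<forall>\<nu>. c \<nu> \<noteq> 0"
  shows "basis_on (walk_states a) {1..a - 1} (walk_phi a p q c)"
proof -
  let ?I = "{1..a - 1}" and ?\<phi> = "walk_phi a p q c"
  let ?L = "matrix_op (walk_states a) (walk_matrix a p q)"
  let ?\<mu> = "\<lambda>\<nu>. complex_of_real (walk_eigenvalue a p q \<nu>)"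
  have L: "?L (?\<phi> \<nu>) = fscale (?\<mu> \<nu>) (?\<phi> \<nu>)" and nz: "?\<phi> \<nu> \<noteq> 0" if "\<nu> \<in> ?I" for \<nu>
    using walk_phi_eigenvector[OF pq that] c by (auto simp: eigenvector_def eigenspace_def)
  have inj\<mu>: "inj_on ?\<mu> ?I"
    using inj_on_walk_eigenvalue[OF pq, of a] by (simp add: inj_on_def)
  have inj: "inj_on ?\<phi> ?I"
  proof
    fix i j assume ij: "i \<in> ?I" "j \<in> ?I" "?\<phi> i = ?\<phi> j"
    then have "fscale (?\<mu> i) (?\<phi> i) = fscale (?\<mu> j) (?\<phi> i)" using L by metis
    then have "?\<mu> i = ?\<mu> j" using nz[OF ij(1)] by (metis cfun.scale_cancel_right)
    then show "i = j" using inj_onD[OF inj\<mu>] ij(1,2) by blast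
  qed
  have ind: "cfun.independent (?\<phi> ` ?I)"
  proof (rule independent_eigenvectors[OF linear_matrix_op])
    show "inj_on (?\<mu> \<circ> inv_into ?I ?\<phi>) (?\<phi> ` ?I)"
      by (rule comp_inj_on) (simp_all only: inv_into_image_cancel[OF inj order.refl] inj\<mu> inj_on_inv_into order.refl)
    show "?L b = fscale ((?\<mu> \<circ> inv_into ?I ?\<phi>) b) b" if "b \<in> ?\<phi> ` ?I" for b
      using that L inj by (auto simp: inv_into_f_f)
    show "0 \<notin> ?\<phi> ` ?I" using nz by force
  qed simp
  have "cfun.span (?\<phi> ` ?I) = funs_on (walk_states a)"
  proof (rule independent_spans_funs_on[OF _ ind])
    show "card (?\<phi> ` ?I) = card (walk_states a)"
      by (simp only: card_image[OF inj] walk_states_def)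
  qed (auto simp: walk_phi_in_funs_on, simp add: walk_states_def)
  with inj ind show ?thesis by (simp add: basis_on_def)
qed

lemma walk_parity_basis:
  assumes pq: "p > 0" "q > 0" "p + q = 1" and c: "\<forall>\<nu>. c \<nu> \<noteq> 0"
  shows "parity_basis (walk_states a) (walk_sigma a) (walk_kappa a p q) (walk_K a p q)
           (walk_matrix a p q) (walk_phi a p q c) walk_sign"
proof -
  have card: "card (walk_states a) = a - 1" by (simp add: walk_states_def)
  have sign: "walk_sign \<nu> \<in> {1, -1}" for \<nu> by (cases "even \<nu>") (auto simp: walk_sign_def)
  show ?thesis
    unfolding parity_basis_def card
  proof (intro conjI ballI)
    fix \<nu> assume \<nu>: "\<nu> \<in> {1..a - 1}"
    then show "\<exists>\<mu>. eigenvector (walk_states a) (matrix_op (walk_states a) (walk_matrix a p q)) \<mu>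
                 (walk_phi a p q c \<nu>)"
      using walk_phi_eigenvector[OF pq(1,2) \<nu>] c by blast
    show "T_op (walk_states a) (walk_sigma a) (walk_kappa a p q) (walk_phi a p q c \<nu>) =
          fscale (complex_of_real (walk_sign \<nu> * sqrt (walk_K a p q))) (walk_phi a p q c \<nu>)"
      using \<nu> by (intro walk_T_phi[OF pq(1,2)]) auto
  qed (rule walk_transition_matrix[OF pq] walk_basis[OF pq(1,2) c] sign)+
qed

lemma walk_sign_eq_iff: "walk_sign \<nu> = 1 \<longleftrightarrow> odd \<nu>" "walk_sign \<nu> = -1 \<longleftrightarrow> even \<nu>"
  by (cases "even \<nu>"; simp add: walk_sign_def)+

lemma card_even_interval: "card {\<nu>\<in>{1..n}. even \<nu>} = n div 2"
proof (induction n)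
  case (Suc n)
  have "{\<nu>\<in>{1..Suc n}. even \<nu>} = {\<nu>\<in>{1..n}. even \<nu>} \<union> (if even (Suc n) then {Suc n} else {})"
    by (auto simp: le_Suc_eq)
  then show ?case using Suc by (simp; presburger)
qed simp

lemma card_odd_interval: "card {\<nu>\<in>{1..n}. odd \<nu>} = Suc n div 2"
proof (induction n)
  case (Suc n)
  have "{\<nu>\<in>{1..Suc n}. odd \<nu>} = {\<nu>\<in>{1..n}. odd \<nu>} \<union> (if odd (Suc n) then {Suc n} else {})"
    by (auto simp: le_Suc_eq)
  then show ?case using Suc by (simp; presburger)
qed simp

text \<open>
  The multiplicities do not involve the normalisation of the eigenvectors, so the basis with all
  factors equal to one may be used to count signs.
\<close>
lemma walk_multiplicities:
  assumes pq: "p > 0" "q > 0" "p + q = 1" and a: "a \<ge> 2"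
    and mult: "mult \<in> {geometric_multiplicity (walk_states a) (walk_T a p q),
                       algebraic_multiplicity (walk_states a) (walk_T a p q)}"
  shows "mult (complex_of_real (sqrt (walk_K a p q))) = a div 2"
    and "mult (- complex_of_real (sqrt (walk_K a p q))) = (a - 1) div 2"
proof -
  note w = walk_weighted_involution[OF pq(1,2), of a]
  have K: "walk_K a p q > 0" using pq by (simp add: walk_K_def)
  have ne: "walk_states a \<noteq> {}" and card: "card (walk_states a) = a - 1"
    using a by (auto simp: walk_states_def)
  have b: "parity_basis (walk_states a) (walk_sigma a) (walk_kappa a p q) (walk_K a p q)
             (walk_matrix a p q) (walk_phi a p q (\<lambda>_. 1)) walk_sign"
    by (rule walk_parity_basis[OF pq]) simp
  have "mult (complex_of_real (e * sqrt (walk_K a p q))) = card {\<nu>\<in>{1..a - 1}. walk_sign \<nu> = e}"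
    if e: "e \<in> {1, -1}" for e
  proof -
    let ?\<mu> = "complex_of_real (e * sqrt (walk_K a p q))"
    have "?\<mu> * ?\<mu> = complex_of_real (walk_K a p q)" "?\<mu> \<noteq> 0"
      using e K by (auto simp flip: of_real_mult)
    note gen = generalized_eigenspace_T_op[OF w this]
    have "mult ?\<mu> = cfun.dim (eigenspace (walk_states a) (walk_T a p q) ?\<mu>)"
      using mult gen
      by (auto simp: geometric_multiplicity_def algebraic_multiplicity_def walk_T_def)
    then show ?thesis
      using dim_parity_eigenspace[OF w b ne e] by (simp add: walk_T_def card)
  qed
  from this[of 1] this[of "-1"]
  show "mult (complex_of_real (sqrt (walk_K a p q))) = a div 2"
    and "mult (- complex_of_real (sqrt (walk_K a p q))) = (a - 1) div 2"
    using card_odd_interval[of "a - 1"] card_even_interval[of "a - 1"] a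
    by (simp_all add: walk_sign_eq_iff)
qed

lemma walk_sign_image:
  assumes "a \<ge> 3"
  shows "walk_sign ` {1..a - 1} = {1, -1}"
proof
  show "walk_sign ` {1..a - 1} \<subseteq> {1, -1}" using walk_sign_eq_iff by blast
  have "1 \<in> {1..a - 1}" "2 \<in> {1..a - 1}" "walk_sign 1 = 1" "walk_sign 2 = -1"
    using assms by (auto simp: walk_sign_eq_iff)
  then show "{1, -1} \<subseteq> walk_sign ` {1..a - 1}" by (metis empty_subsetI imageI insert_subset)
qed

theorem mainTheorem7:
  "(\<forall>(S :: 'a set) \<sigma> \<kappa> K. weighted_involution S \<sigma> \<kappa> K \<longrightarrow>
      (\<forall>f\<in>funs_on S. \<forall>z\<in>S. T_op S \<sigma> \<kappa> f z = complex_of_real (\<kappa> z) * f (\<sigma> z)) \<and>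
      (\<forall>f\<in>funs_on S. T_op S \<sigma> \<kappa> (T_op S \<sigma> \<kappa> f) = fscale (complex_of_real K) f) \<and>
      spec S (T_op S \<sigma> \<kappa>) \<subseteq> {complex_of_real (sqrt K), - complex_of_real (sqrt K)} \<and>
      (\<forall>f\<in>funs_on S. normalized_T_op S \<sigma> \<kappa> K (normalized_T_op S \<sigma> \<kappa> K f) = f) \<and>
      (\<forall>P \<phi> \<epsilon>. S \<noteq> {} \<and> parity_basis S \<sigma> \<kappa> K P \<phi> \<epsilon> \<and> (\<forall>\<nu>\<in>{1..card S}. \<epsilon> \<nu> = 1) \<longrightarrow>
         spec S (T_op S \<sigma> \<kappa>) = {complex_of_real (sqrt K)}))
   \<and>
   (\<forall>(S :: 'a set) K. finite S \<and> S \<noteq> {} \<and> K > 0 \<longrightarrow>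
      (\<exists>\<sigma> \<kappa> P \<phi> \<epsilon>. weighted_involution S \<sigma> \<kappa> K \<and> parity_basis S \<sigma> \<kappa> K P \<phi> \<epsilon> \<and>
         (\<forall>\<nu>\<in>{1..card S}. \<epsilon> \<nu> = 1)))
   \<and>
   (\<forall>(a :: nat) (p :: real) (q :: real) (c :: nat \<Rightarrow> complex).
      a \<ge> 2 \<and> p > 0 \<and> q > 0 \<and> p + q = 1 \<and> (\<forall>\<nu>. c \<nu> \<noteq> 0) \<longrightarrow>
      weighted_involution (walk_states a) (walk_sigma a) (walk_kappa a p q) (walk_K a p q) \<and>
      parity_basis (walk_states a) (walk_sigma a) (walk_kappa a p q) (walk_K a p q)
        (walk_matrix a p q) (walk_phi a p q c) walk_sign \<and>
      (\<forall>\<nu>\<in>{1..a - 1}.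
         eigenvector (walk_states a) (matrix_op (walk_states a) (walk_matrix a p q))
           (complex_of_real (walk_eigenvalue a p q \<nu>)) (walk_phi a p q c \<nu>)) \<and>
      (a \<ge> 3 \<longrightarrow>
         (\<forall>\<nu>\<in>{1..a - 1}. walk_T a p q (walk_phi a p q c \<nu>) =
            fscale (complex_of_real ((- 1) ^ (\<nu> + 1) * sqrt (walk_K a p q)))
              (walk_phi a p q c \<nu>)) \<and>
         walk_sign ` {1..a - 1} = {1, - 1} \<and>
         spec (walk_states a) (walk_T a p q) =
           {complex_of_real (sqrt (walk_K a p q)), - complex_of_real (sqrt (walk_K a p q))} \<and>
         (\<forall>mult \<in> {geometric_multiplicity (walk_states a) (walk_T a p q),
                   algebraic_multiplicity (walk_states a) (walk_T a p q)}.
            int (mult (complex_of_real (sqrt (walk_K a p q)))) = \<lceil>(real a - 1) / 2\<rceil> \<and>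
            int (mult (- complex_of_real (sqrt (walk_K a p q)))) = \<lfloor>(real a - 1) / 2\<rfloor> \<and>
            (odd a \<longrightarrow> mult (complex_of_real (sqrt (walk_K a p q)))
                        = mult (- complex_of_real (sqrt (walk_K a p q)))) \<and>
            (even a \<longrightarrow> mult (complex_of_real (sqrt (walk_K a p q)))
                        = mult (- complex_of_real (sqrt (walk_K a p q))) + 1))) \<and>
      (a = 2 \<longrightarrow>
         card {1..a - 1} = 1 \<and> walk_sign ` {1..a - 1} = {1} \<and>
         walk_T a p q (walk_phi a p q c 1) =
           fscale (complex_of_real (sqrt (walk_K a p q))) (walk_phi a p q c 1) \<and>
         spec (walk_states a) (walk_T a p q) = {complex_of_real (sqrt (walk_K a p q))}))"
proof (intro conjI, goal_cases)
  case 1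
  show ?case
  proof (intro allI impI conjI ballI)
    fix S :: "'a set" and \<sigma> \<kappa> K assume w: "weighted_involution S \<sigma> \<kappa> K"
    show "T_op S \<sigma> \<kappa> f z = complex_of_real (\<kappa> z) * f (\<sigma> z)" if "z \<in> S" for f z
      using that by (simp add: T_op_apply[OF w])
    show "T_op S \<sigma> \<kappa> (T_op S \<sigma> \<kappa> f) = fscale (complex_of_real K) f" if "f \<in> funs_on S" for f
      by (rule T_op_square[OF w that])
    show "spec S (T_op S \<sigma> \<kappa>) \<subseteq> {complex_of_real (sqrt K), - complex_of_real (sqrt K)}"
      by (rule spec_T_op_subset[OF w])
    show "normalized_T_op S \<sigma> \<kappa> K (normalized_T_op S \<sigma> \<kappa> K f) = f" if "f \<in> funs_on S" for f
      by (rule normalized_T_op_involution[OF w that])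
    fix P \<phi> \<epsilon>
    assume *: "S \<noteq> {} \<and> parity_basis S \<sigma> \<kappa> K P \<phi> \<epsilon> \<and> (\<forall>\<nu>\<in>{1..card S}. \<epsilon> \<nu> = 1)"
    have "card S \<noteq> 0" using w * by (simp add: weighted_involution_def)
    have "spec S (T_op S \<sigma> \<kappa>) = (\<lambda>\<nu>. complex_of_real (\<epsilon> \<nu> * sqrt K)) ` {1..card S}"
      using * by (intro spec_parity[OF w]) auto
    also have "\<dots> = (\<lambda>\<nu>. complex_of_real (sqrt K)) ` {1..card S}"
      using * by (intro image_cong) auto
    also have "\<dots> = {complex_of_real (sqrt K)}"
      using \<open>card S \<noteq> 0\<close> by (subst image_constant_conv) auto
    finally show "spec S (T_op S \<sigma> \<kappa>) = {complex_of_real (sqrt K)}" .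
  qed
next
  case 2
  show ?case using trivial_parity_exists by blast
next
  case 3
  show ?case
  proof (intro allI impI)
    fix a :: nat and p q :: real and c :: "nat \<Rightarrow> complex"
    assume asm: "a \<ge> 2 \<and> p > 0 \<and> q > 0 \<and> p + q = 1 \<and> (\<forall>\<nu>. c \<nu> \<noteq> 0)"
    then have a: "a \<ge> 2" and pq: "p > 0" "q > 0" "p + q = 1" and c: "\<forall>\<nu>. c \<nu> \<noteq> 0" by auto
    let ?S = "walk_states a" and ?s = "complex_of_real (sqrt (walk_K a p q))"
    have w: "weighted_involution ?S (walk_sigma a) (walk_kappa a p q) (walk_K a p q)"
      by (rule walk_weighted_involution[OF pq(1,2)])
    have b: "parity_basis ?S (walk_sigma a) (walk_kappa a p q) (walk_K a p q)
               (walk_matrix a p q) (walk_phi a p q c) walk_sign"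
      by (rule walk_parity_basis[OF pq c])
    have ev: "\<forall>\<nu>\<in>{1..a - 1}. eigenvector ?S (matrix_op ?S (walk_matrix a p q))
                (complex_of_real (walk_eigenvalue a p q \<nu>)) (walk_phi a p q c \<nu>)"
      using walk_phi_eigenvector[OF pq(1,2)] c by blast
    have T: "walk_T a p q (walk_phi a p q c \<nu>) =
        fscale (complex_of_real ((- 1) ^ (\<nu> + 1) * sqrt (walk_K a p q))) (walk_phi a p q c \<nu>)" for \<nu>
      using walk_T_phi[OF pq(1,2), of a c \<nu>] a by (simp only: walk_T_def walk_sign_def)
    have ne: "?S \<noteq> {}" and card: "card ?S = a - 1" using a by (auto simp: walk_states_def)
    have spec: "spec ?S (walk_T a p q) =
        (\<lambda>e. complex_of_real (e * sqrt (walk_K a p q))) ` walk_sign ` {1..a - 1}"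
      unfolding walk_T_def spec_parity[OF w b ne] card image_image ..
    have ceiling: "\<lceil>(real a - 1) / 2\<rceil> = int (a div 2)" and floor: "\<lfloor>(real a - 1) / 2\<rfloor> = int ((a - 1) div 2)"
    proof -
      show "\<lceil>(real a - 1) / 2\<rceil> = int (a div 2)"
        by (cases "even a") (auto elim!: evenE oddE intro!: ceiling_unique)
      show "\<lfloor>(real a - 1) / 2\<rfloor> = int ((a - 1) div 2)"
        using floor_divide_of_nat_eq[of "a - 1" 2] a by (simp add: of_nat_diff)
    qed
    have mult: "int (mult ?s) = \<lceil>(real a - 1) / 2\<rceil> \<and> int (mult (- ?s)) = \<lfloor>(real a - 1) / 2\<rfloor> \<and>
        (odd a \<longrightarrow> mult ?s = mult (- ?s)) \<and> (even a \<longrightarrow> mult ?s = mult (- ?s) + 1)"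
      if m: "mult \<in> {geometric_multiplicity ?S (walk_T a p q), algebraic_multiplicity ?S (walk_T a p q)}"
      for mult
      unfolding walk_multiplicities[OF pq a m] ceiling floor using a by (auto elim!: evenE oddE)
    show "weighted_involution ?S (walk_sigma a) (walk_kappa a p q) (walk_K a p q) \<and>
      parity_basis ?S (walk_sigma a) (walk_kappa a p q) (walk_K a p q)
        (walk_matrix a p q) (walk_phi a p q c) walk_sign \<and>
      (\<forall>\<nu>\<in>{1..a - 1}. eigenvector ?S (matrix_op ?S (walk_matrix a p q))
           (complex_of_real (walk_eigenvalue a p q \<nu>)) (walk_phi a p q c \<nu>)) \<and>
      (a \<ge> 3 \<longrightarrow>
         (\<forall>\<nu>\<in>{1..a - 1}. walk_T a p q (walk_phi a p q c \<nu>) =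
            fscale (complex_of_real ((- 1) ^ (\<nu> + 1) * sqrt (walk_K a p q)))
              (walk_phi a p q c \<nu>)) \<and>
         walk_sign ` {1..a - 1} = {1, - 1} \<and>
         spec ?S (walk_T a p q) = {?s, - ?s} \<and>
         (\<forall>mult \<in> {geometric_multiplicity ?S (walk_T a p q),
                   algebraic_multiplicity ?S (walk_T a p q)}.
            int (mult ?s) = \<lceil>(real a - 1) / 2\<rceil> \<and> int (mult (- ?s)) = \<lfloor>(real a - 1) / 2\<rfloor> \<and>
            (odd a \<longrightarrow> mult ?s = mult (- ?s)) \<and> (even a \<longrightarrow> mult ?s = mult (- ?s) + 1))) \<and>
      (a = 2 \<longrightarrow>
         card {1..a - 1} = 1 \<and> walk_sign ` {1..a - 1} = {1} \<and>
         walk_T a p q (walk_phi a p q c 1) = fscale ?s (walk_phi a p q c 1) \<and>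
         spec ?S (walk_T a p q) = {?s})"
    proof (intro conjI impI)
      assume a3: "a \<ge> 3"
      show sign: "walk_sign ` {1..a - 1} = {1, - 1}" by (rule walk_sign_image[OF a3])
      show "spec ?S (walk_T a p q) = {?s, - ?s}" unfolding spec sign by simp
      show "\<forall>\<nu>\<in>{1..a - 1}. walk_T a p q (walk_phi a p q c \<nu>) =
            fscale (complex_of_real ((- 1) ^ (\<nu> + 1) * sqrt (walk_K a p q))) (walk_phi a p q c \<nu>)"
        using T by blast
      show "\<forall>mult \<in> {geometric_multiplicity ?S (walk_T a p q), algebraic_multiplicity ?S (walk_T a p q)}.
            int (mult ?s) = \<lceil>(real a - 1) / 2\<rceil> \<and> int (mult (- ?s)) = \<lfloor>(real a - 1) / 2\<rfloor> \<and>
            (odd a \<longrightarrow> mult ?s = mult (- ?s)) \<and> (even a \<longrightarrow> mult ?s = mult (- ?s) + 1)"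
        using mult by blast
    next
      assume a2: "a = 2"
      show "card {1..a - 1} = 1" using a2 by simp
      show sign: "walk_sign ` {1..a - 1} = {1}" using a2 by (simp add: walk_sign_def)
      show "walk_T a p q (walk_phi a p q c 1) = fscale ?s (walk_phi a p q c 1)"
        unfolding T by simp
      show "spec ?S (walk_T a p q) = {?s}" unfolding spec sign by simp
    qed (use w b ev in blast)+
  qed
qed

end
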